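(* Let $\alpha\in\mathbb Z\setminus\{0,1\}$ and let $(h_n)$ be the sequence with $h_0=0$, $h_1=1$, $h_2=-\alpha^3(\alpha-1)(2\alpha-1)$, $h_3=-\alpha^8(\alpha-1)^3(2\alpha-1)^3$, $h_4=\alpha^{14}(\alpha-1)^6(2\alpha-1)^6$, and for $m\ge2$: $h_{2m+1}=h_{m+2}h_m^3-h_{m-1}h_{m+1}^3$, for $m\ge 3$: $h_{2m}=h_m\big(h_{m+2}h_{m-1}^2-h_{m-2}h_{m+1}^2\big)/h_2$. If $n\equiv 2,6,7,9,10,14\pmod{16}$, then $h_n$ is not a square.
   Context: The sequence defined is the elliptic divisibility sequence attached to the point $(0,0)$ of order $8$ on the curve $y^2+(\alpha-\xi)xy-\alpha^3\xi y=x^3-\alpha^2\xi x^2$ with $\xi=(2\alpha-1)(\alpha-1)$. Convention: an integer $m$ is called a square if $m=\pm\beta^2$ for some nonzero integer $\beta$. *)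

theory Defs
  imports Complex_Main
begin

(* Squares up to sign; zero is deliberately excluded. *)
definition signed_square :: "int \<Rightarrow> bool" where
  "signed_square m \<longleftrightarrow> (\<exists>\<beta>. \<beta> \<noteq> 0 \<and> (m = \<beta>\<^sup>2 \<or> m = - (\<beta>\<^sup>2)))"

(* The recurrence divides by h 2, so it is stated over the rationals; integrality of
   the terms is a consequence of the recurrence, not part of the definition.
   The truncated subtractions are exact under the stated lower bounds on m. *)
definition eds_order8 :: "int \<Rightarrow> (nat \<Rightarrow> rat) \<Rightarrow> bool" where
  "eds_order8 \<alpha> h \<longleftrightarrow>
     h 0 = 0 \<and>
     h 1 = 1 \<and>
     h 2 = of_int (- (\<alpha> ^ 3 * (\<alpha> - 1) * (2 * \<alpha> - 1))) \<and>
     h 3 = of_int (- (\<alpha> ^ 8 * (\<alpha> - 1) ^ 3 * (2 * \<alpha> - 1) ^ 3)) \<and>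
     h 4 = of_int (\<alpha> ^ 14 * (\<alpha> - 1) ^ 6 * (2 * \<alpha> - 1) ^ 6) \<and>
     (\<forall>m\<ge>2. h (2 * m + 1) = h (m + 2) * h m ^ 3 - h (m - 1) * h (m + 1) ^ 3) \<and>
     (\<forall>m\<ge>3. h (2 * m) =
        h m * (h (m + 2) * (h (m - 1))\<^sup>2 - h (m - 2) * (h (m + 1))\<^sup>2) / h 2)"

end

theory Submission
  imports Defs "HOL-Computational_Algebra.Nth_Powers"
begin

text \<open>
  Put \<open>x = \<alpha>\<close>, \<open>y = \<alpha> - 1\<close>, \<open>z = 2\<alpha> - 1\<close>. Since the point has order 8, the sequence is
  quasi-periodic: \<open>h (n + 8) = - A ^ (n + 4) * h n\<close> with \<open>A = - x\<^sup>1\<^sup>5 y\<^sup>7 z\<^sup>6\<close>, and the terms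
  \<open>h 0, \<dots>, h 7\<close> are zero or signed monomials in \<open>x, y, z\<close>. Both sides of each recurrence scale
  by the same power of \<open>A\<close> when the index is shifted by 8, so only eight instances of each have to
  be checked; these reduce to \<open>x - y = 1\<close>, \<open>x + y = z\<close> and \<open>x\<^sup>2 - y\<^sup>2 = z\<close>.
  Modulo squares, \<open>h n\<close> depends on \<open>n mod 16\<close> only, and in the residue classes considered it is
  \<open>\<plusminus> x y\<close> or \<open>\<plusminus> x y z\<close>. As \<open>4 x y = z\<^sup>2 - 1\<close>, the numbers \<open>x y\<close> and \<open>z\<close> are coprime, and
  \<open>x y = \<alpha>\<^sup>2 - \<alpha>\<close> lies strictly between consecutive squares.
\<close>

lemma nat_induct_step_8:
  fixes P :: "nat \<Rightarrow> bool"
  assumes "P 0" "P 1" "P 2" "P 3" "P 4" "P 5" "P 6" "P 7"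
    and step: "\<And>n. P n \<Longrightarrow> P (n + 8)"
  shows "P n"
proof (induction n rule: less_induct)
  case (less n)
  show ?case
  proof (cases "n < 8")
    case True
    then have "n \<in> {0, 1, 2, 3, 4, 5, 6, 7}" by auto
    then show ?thesis using assms by blast
  next
    case False
    then show ?thesis using less.IH[of "n - 8"] step[of "n - 8"] by simp
  qed
qed

section \<open>Signed monomials in \<open>x\<close>, \<open>y\<close>, \<open>z\<close> and their
  shifts by 8 and 16\<close>

context
  fixes x y z :: int
begin

text \<open>The factor by which the quotient of the terms at \<open>n + 8\<close> and
  \<open>n\<close> grows when \<open>n\<close> increases by 1, wherever these quotients
  exist.\<close>

definition quasi_period :: int where
  "quasi_period = - (x ^ 15 * y ^ 7 * z ^ 6)"

text \<open>Here \<open>x\<close>, \<open>y\<close>, \<open>z\<close> are independent: shifts and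
  classes modulo squares are then pure exponent arithmetic, and the relations between the three
  enter only where the recurrences are checked.\<close>

fun eds_monomial :: "nat \<Rightarrow> int" where
  "eds_monomial n =
     (if n = 0 then 0
      else if n = 1 then 1
      else if n = 2 then - (x ^ 3 * y * z)
      else if n = 3 then - (x ^ 8 * y ^ 3 * z ^ 3)
      else if n = 4 then x ^ 14 * y ^ 6 * z ^ 6
      else if n = 5 then x ^ 23 * y ^ 10 * z ^ 9
      else if n = 6 then - (x ^ 33 * y ^ 15 * z ^ 13)
      else if n = 7 then - (x ^ 45 * y ^ 21 * z ^ 18)
      else - (quasi_period ^ (n - 4)) * eds_monomial (n - 8))"

declare eds_monomial.simps [simp del]

lemma eds_monomial_base:
  "eds_monomial 0 = 0"
  "eds_monomial (Suc 0) = 1"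
  "eds_monomial 2 = - (x ^ 3 * y * z)"
  "eds_monomial 3 = - (x ^ 8 * y ^ 3 * z ^ 3)"
  "eds_monomial 4 = x ^ 14 * y ^ 6 * z ^ 6"
  "eds_monomial 5 = x ^ 23 * y ^ 10 * z ^ 9"
  "eds_monomial 6 = - (x ^ 33 * y ^ 15 * z ^ 13)"
  "eds_monomial 7 = - (x ^ 45 * y ^ 21 * z ^ 18)"
  by (simp_all add: eds_monomial.simps)

lemma eds_monomial_add_8:
  "eds_monomial (n + 8) = - (quasi_period ^ (n + 4)) * eds_monomial n"
  by (subst eds_monomial.simps) (simp add: add.commute)

lemma eds_monomial_add_16:
  "eds_monomial (n + 16) = (quasi_period ^ (n + 8))\<^sup>2 * eds_monomial n"
  using eds_monomial_add_8[of "n + 8"] eds_monomial_add_8[of n]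
  by (simp add: power_add power2_eq_square power_mult_distrib mult.assoc numeral_eq_Suc)

text \<open>The table ends at 19 = 2 * 7 + 5, the largest index in the recurrence instances with
  \<open>j\<close> from 0 to 7.\<close>

lemma eds_monomial_8_to_19:
  "eds_monomial 8 = 0"
  "eds_monomial 9 = x ^ 75 * y ^ 35 * z ^ 30"
  "eds_monomial 10 = x ^ 93 * y ^ 43 * z ^ 37"
  "eds_monomial 11 = - (x ^ 113 * y ^ 52 * z ^ 45)"
  "eds_monomial 12 = - (x ^ 134 * y ^ 62 * z ^ 54)"
  "eds_monomial 13 = x ^ 158 * y ^ 73 * z ^ 63"
  "eds_monomial 14 = x ^ 183 * y ^ 85 * z ^ 73"
  "eds_monomial 15 = - (x ^ 210 * y ^ 98 * z ^ 84)"
  "eds_monomial 16 = 0"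
  "eds_monomial 17 = x ^ 270 * y ^ 126 * z ^ 108"
  "eds_monomial 18 = - (x ^ 303 * y ^ 141 * z ^ 121)"
  "eds_monomial 19 = - (x ^ 338 * y ^ 157 * z ^ 135)"
proof -
  note shift = eds_monomial_add_8[of 0, simplified] eds_monomial_add_8[of 1, simplified]
    eds_monomial_add_8[of 2, simplified] eds_monomial_add_8[of 3, simplified]
    eds_monomial_add_8[of 4, simplified] eds_monomial_add_8[of 5, simplified]
    eds_monomial_add_8[of 6, simplified] eds_monomial_add_8[of 7, simplified]
    eds_monomial_add_16[of 0, simplified] eds_monomial_add_16[of 1, simplified]
    eds_monomial_add_16[of 2, simplified] eds_monomial_add_16[of 3, simplified]
  show
    "eds_monomial 8 = 0"
    "eds_monomial 9 = x ^ 75 * y ^ 35 * z ^ 30"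
    "eds_monomial 10 = x ^ 93 * y ^ 43 * z ^ 37"
    "eds_monomial 11 = - (x ^ 113 * y ^ 52 * z ^ 45)"
    "eds_monomial 12 = - (x ^ 134 * y ^ 62 * z ^ 54)"
    "eds_monomial 13 = x ^ 158 * y ^ 73 * z ^ 63"
    "eds_monomial 14 = x ^ 183 * y ^ 85 * z ^ 73"
    "eds_monomial 15 = - (x ^ 210 * y ^ 98 * z ^ 84)"
    "eds_monomial 16 = 0"
    "eds_monomial 17 = x ^ 270 * y ^ 126 * z ^ 108"
    "eds_monomial 18 = - (x ^ 303 * y ^ 141 * z ^ 121)"
    "eds_monomial 19 = - (x ^ 338 * y ^ 157 * z ^ 135)"
    unfolding shift eds_monomial_base quasi_period_def by algebra+
qed

section \<open>The two recurrences for the monomials\<close>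

text \<open>Writing \<open>m = j + 2\<close> makes every index a sum, so no truncated subtraction
  occurs.\<close>

lemma eds_monomial_odd:
  assumes y: "y = x - 1" and z: "z = x + y"
  shows "eds_monomial (2 * j + 5) =
    eds_monomial (j + 4) * eds_monomial (j + 2) ^ 3 - eds_monomial (j + 1) * eds_monomial (j + 3) ^ 3"
proof -
  have relation: "x - 1 = y" "x\<^sup>2 - z = y\<^sup>2"
    using y z by algebra+
  show ?thesis
  proof (induction j rule: nat_induct_step_8)
    \<comment> \<open>Case number \<open>k\<close> is the instance \<open>j = k - 1\<close>. In the
      first four, the common monomial is factored out, and the remaining binomial is
      \<open>y\<close> or \<open>y\<^sup>2\<close> up to sign by \<open>relation\<close>.\<close>
    case 1
    have "eds_monomial 4 * eds_monomial 2 ^ 3 - eds_monomial (Suc 0) * eds_monomial 3 ^ 3 = x ^ 23 * y ^ 9 * z ^ 9 * (x - 1)"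
      unfolding eds_monomial_base eds_monomial_8_to_19 by algebra
    also have "\<dots> = eds_monomial 5"
      unfolding eds_monomial_base eds_monomial_8_to_19 relation by algebra
    finally show ?case by (simp flip: numeral_2_eq_2)
  next
    case 2
    have "eds_monomial 5 * eds_monomial 3 ^ 3 - eds_monomial 2 * eds_monomial 4 ^ 3
        = - (x ^ 45 * y ^ 19 * z ^ 18 * (x\<^sup>2 - z))"
      unfolding eds_monomial_base eds_monomial_8_to_19 by algebra
    also have "\<dots> = eds_monomial 7"
      unfolding eds_monomial_base eds_monomial_8_to_19 relation by algebra
    finally show ?case by (simp flip: numeral_2_eq_2)
  next
    case 3
    have "eds_monomial 6 * eds_monomial 4 ^ 3 - eds_monomial 3 * eds_monomial 5 ^ 3 = x ^ 75 * y ^ 33 * z ^ 30 * (x\<^sup>2 - z)"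
      unfolding eds_monomial_base eds_monomial_8_to_19 by algebra
    also have "\<dots> = eds_monomial 9"
      unfolding eds_monomial_base eds_monomial_8_to_19 relation by algebra
    finally show ?case by (simp flip: numeral_2_eq_2)
  next
    case 4
    have "eds_monomial 7 * eds_monomial 5 ^ 3 - eds_monomial 4 * eds_monomial 6 ^ 3
        = - (x ^ 113 * y ^ 51 * z ^ 45 * (x - 1))"
      unfolding eds_monomial_base eds_monomial_8_to_19 by algebra
    also have "\<dots> = eds_monomial 11"
      unfolding eds_monomial_base eds_monomial_8_to_19 relation by algebra
    finally show ?case by (simp flip: numeral_2_eq_2)
  next
    case 5
    \<comment> \<open>From here to \<open>j = 7\<close> the vanishing term at index 8 kills one
      product, and the other already has the right exponents.\<close>
    have "eds_monomial 13 = eds_monomial 8 * eds_monomial 6 ^ 3 - eds_monomial 5 * eds_monomial 7 ^ 3"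
      unfolding eds_monomial_base eds_monomial_8_to_19 power_zero_numeral by algebra
    then show ?case by (simp flip: numeral_2_eq_2)
  next
    case 6
    have "eds_monomial 15 = eds_monomial 9 * eds_monomial 7 ^ 3 - eds_monomial 6 * eds_monomial 8 ^ 3"
      unfolding eds_monomial_base eds_monomial_8_to_19 power_zero_numeral by algebra
    then show ?case by (simp flip: numeral_2_eq_2)
  next
    case 7
    have "eds_monomial 17 = eds_monomial 10 * eds_monomial 8 ^ 3 - eds_monomial 7 * eds_monomial 9 ^ 3"
      unfolding eds_monomial_base eds_monomial_8_to_19 power_zero_numeral by algebra
    then show ?case by (simp flip: numeral_2_eq_2)
  next
    case 8
    have "eds_monomial 19 = eds_monomial 11 * eds_monomial 9 ^ 3 - eds_monomial 8 * eds_monomial 10 ^ 3"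
      unfolding eds_monomial_base eds_monomial_8_to_19 power_zero_numeral by algebra
    then show ?case by (simp flip: numeral_2_eq_2)
  next
    case (9 j)
    define A where "A = quasi_period"
    \<comment> \<open>Shifting \<open>j\<close> by 8 shifts the left index by 16, which gives the
      exponent 2 * (2 * j + 5 + 8).\<close>
    have "eds_monomial (2 * (j + 8) + 5) = A ^ (4 * j + 26) * eds_monomial (2 * j + 5)"
      using eds_monomial_add_16[of "2 * j + 5"] by (simp add: A_def power2_eq_square add.commute flip: power_add)
    also have "\<dots> = (- (A ^ (j + 8)) * eds_monomial (j + 4)) * (- (A ^ (j + 6)) * eds_monomial (j + 2)) ^ 3
        - (- (A ^ (j + 5)) * eds_monomial (j + 1)) * (- (A ^ (j + 7)) * eds_monomial (j + 3)) ^ 3"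
    proof -
      \<comment> \<open>Each product on the right has four factors, so the four minus signs cancel
        and only the exponents need to agree.\<close>
      have "A ^ (4 * j + 26) = A ^ (j + 8) * (A ^ (j + 6)) ^ 3"
        by (simp add: add.commute flip: power_mult power_add)
      then have left: "A ^ (4 * j + 26) * (eds_monomial (j + 4) * eds_monomial (j + 2) ^ 3)
          = (- (A ^ (j + 8)) * eds_monomial (j + 4)) * (- (A ^ (j + 6)) * eds_monomial (j + 2)) ^ 3"
        by (simp add: power_mult_distrib mult_ac)
      have "A ^ (4 * j + 26) = A ^ (j + 5) * (A ^ (j + 7)) ^ 3"
        by (simp add: add.commute flip: power_mult power_add)
      then have right: "A ^ (4 * j + 26) * (eds_monomial (j + 1) * eds_monomial (j + 3) ^ 3)
          = (- (A ^ (j + 5)) * eds_monomial (j + 1)) * (- (A ^ (j + 7)) * eds_monomial (j + 3)) ^ 3"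
        by (simp add: power_mult_distrib mult_ac)
      show ?thesis
        unfolding 9 by (simp only: right_diff_distrib left right)
    qed
    also have "\<dots> = eds_monomial (j + 8 + 4) * eds_monomial (j + 8 + 2) ^ 3
        - eds_monomial (j + 8 + 1) * eds_monomial (j + 8 + 3) ^ 3"
      using eds_monomial_add_8[of "j + 4"] eds_monomial_add_8[of "j + 3"]
        eds_monomial_add_8[of "j + 2"] eds_monomial_add_8[of "j + 1"]
      by (simp add: A_def add.commute add.left_commute)
    finally show ?case .
  qed
qed

text \<open>Multiplying by the term at index 2 keeps the identity in the integers. It also covers
  \<open>m = 2\<close>, so the induction can start at \<open>j = 0\<close>.\<close>

lemma eds_monomial_even:
  assumes y: "y = x - 1" and z: "z = x + y"
  shows "eds_monomial (2 * j + 4) * eds_monomial 2 =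
    eds_monomial (j + 2) * (eds_monomial (j + 4) * (eds_monomial (j + 1))\<^sup>2
      - eds_monomial j * (eds_monomial (j + 3))\<^sup>2)"
proof -
  have relation: "z - x = y"
    using y z by algebra+
  show ?thesis
  proof (induction j rule: nat_induct_step_8)
    case 1
    have "eds_monomial 4 * eds_monomial 2 = eds_monomial 2 * (eds_monomial 4 * (eds_monomial (Suc 0))\<^sup>2 - eds_monomial 0 * (eds_monomial 3)\<^sup>2)"
      unfolding eds_monomial_base eds_monomial_8_to_19 power_one by algebra
    then show ?case by (simp flip: numeral_2_eq_2)
  next
    case 2
    have "eds_monomial 3 * (eds_monomial 5 * (eds_monomial 2)\<^sup>2 - eds_monomial (Suc 0) * (eds_monomial 4)\<^sup>2) = x ^ 36 * y ^ 15 * z ^ 14 * (z - x)"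
      unfolding eds_monomial_base eds_monomial_8_to_19 by algebra
    also have "\<dots> = eds_monomial 6 * eds_monomial 2"
      unfolding eds_monomial_base eds_monomial_8_to_19 relation by algebra
    finally show ?case by (simp flip: numeral_2_eq_2)
  next
    case 3
    \<comment> \<open>The two products on the right are the same monomial, so they cancel, in
      agreement with the zero at index 8.\<close>
    have "eds_monomial 8 * eds_monomial 2 = eds_monomial 4 * (eds_monomial 6 * (eds_monomial 3)\<^sup>2 - eds_monomial 2 * (eds_monomial 5)\<^sup>2)"
      unfolding eds_monomial_base eds_monomial_8_to_19 power_zero_numeral by algebra
    then show ?case by (simp flip: numeral_2_eq_2)
  next
    case 4
    have "eds_monomial 5 * (eds_monomial 7 * (eds_monomial 4)\<^sup>2 - eds_monomial 3 * (eds_monomial 6)\<^sup>2)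
        = - (x ^ 96 * y ^ 43 * z ^ 38 * (z - x))"
      unfolding eds_monomial_base eds_monomial_8_to_19 by algebra
    also have "\<dots> = eds_monomial 10 * eds_monomial 2"
      unfolding eds_monomial_base eds_monomial_8_to_19 relation by algebra
    finally show ?case by (simp flip: numeral_2_eq_2)
  next
    case 5
    have "eds_monomial 12 * eds_monomial 2 = eds_monomial 6 * (eds_monomial 8 * (eds_monomial 5)\<^sup>2 - eds_monomial 4 * (eds_monomial 7)\<^sup>2)"
      unfolding eds_monomial_base eds_monomial_8_to_19 power_zero_numeral by algebra
    then show ?case by (simp flip: numeral_2_eq_2)
  next
    case 6
    have "eds_monomial 14 * eds_monomial 2 = eds_monomial 7 * (eds_monomial 9 * (eds_monomial 6)\<^sup>2 - eds_monomial 5 * (eds_monomial 8)\<^sup>2)"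
      unfolding eds_monomial_base eds_monomial_8_to_19 power_zero_numeral by algebra
    then show ?case by (simp flip: numeral_2_eq_2)
  next
    case 7
    have "eds_monomial 16 * eds_monomial 2 = eds_monomial 8 * (eds_monomial 10 * (eds_monomial 7)\<^sup>2 - eds_monomial 6 * (eds_monomial 9)\<^sup>2)"
      unfolding eds_monomial_base eds_monomial_8_to_19 power_zero_numeral by algebra
    then show ?case by (simp flip: numeral_2_eq_2)
  next
    case 8
    have "eds_monomial 18 * eds_monomial 2 = eds_monomial 9 * (eds_monomial 11 * (eds_monomial 8)\<^sup>2 - eds_monomial 7 * (eds_monomial 10)\<^sup>2)"
      unfolding eds_monomial_base eds_monomial_8_to_19 power_zero_numeral by algebra
    then show ?case by (simp flip: numeral_2_eq_2)
  next
    case (9 j)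
    define A where "A = quasi_period"
    have "eds_monomial (2 * (j + 8) + 4) * eds_monomial 2
        = A ^ (4 * j + 24) * (eds_monomial (2 * j + 4) * eds_monomial 2)"
      using eds_monomial_add_16[of "2 * j + 4"] by (simp add: A_def power2_eq_square add.commute flip: power_add)
    also have "\<dots> = (- (A ^ (j + 6)) * eds_monomial (j + 2)) *
        ((- (A ^ (j + 8)) * eds_monomial (j + 4)) * (- (A ^ (j + 5)) * eds_monomial (j + 1))\<^sup>2
        - (- (A ^ (j + 4)) * eds_monomial j) * (- (A ^ (j + 7)) * eds_monomial (j + 3))\<^sup>2)"
    proof -
      have "A ^ (4 * j + 24) = A ^ (j + 6) * (A ^ (j + 8) * (A ^ (j + 5))\<^sup>2)"
        by (simp add: add.commute flip: power_mult power_add)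
      then have left: "A ^ (4 * j + 24) * (eds_monomial (j + 2) * (eds_monomial (j + 4) * (eds_monomial (j + 1))\<^sup>2))
          = (- (A ^ (j + 6)) * eds_monomial (j + 2)) *
            ((- (A ^ (j + 8)) * eds_monomial (j + 4)) * (- (A ^ (j + 5)) * eds_monomial (j + 1))\<^sup>2)"
        by (simp add: power_mult_distrib mult_ac)
      have "A ^ (4 * j + 24) = A ^ (j + 6) * (A ^ (j + 4) * (A ^ (j + 7))\<^sup>2)"
        by (simp add: add.commute flip: power_mult power_add)
      then have right: "A ^ (4 * j + 24) * (eds_monomial (j + 2) * (eds_monomial j * (eds_monomial (j + 3))\<^sup>2))
          = (- (A ^ (j + 6)) * eds_monomial (j + 2)) *
            ((- (A ^ (j + 4)) * eds_monomial j) * (- (A ^ (j + 7)) * eds_monomial (j + 3))\<^sup>2)"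
        by (simp add: power_mult_distrib mult_ac)
      show ?thesis
        unfolding 9 by (simp only: right_diff_distrib left right)
    qed
    also have "\<dots> = eds_monomial (j + 8 + 2) * (eds_monomial (j + 8 + 4) * (eds_monomial (j + 8 + 1))\<^sup>2
        - eds_monomial (j + 8) * (eds_monomial (j + 8 + 3))\<^sup>2)"
      using eds_monomial_add_8[of "j + 4"] eds_monomial_add_8[of "j + 3"]
        eds_monomial_add_8[of "j + 2"] eds_monomial_add_8[of "j + 1"] eds_monomial_add_8[of j]
      by (simp add: A_def add.commute add.left_commute)
    finally show ?case .
  qed
qed

section \<open>Classes of the monomials modulo squares\<close>

lemma eds_monomial_modulo_squares:
  assumes "x * y * z \<noteq> 0" and "n mod 16 \<in> {2, 6, 7, 9, 10, 14}"
  shows "\<exists>q. q \<noteq> 0 \<and> \<bar>eds_monomial n\<bar> \<in> {q\<^sup>2 * \<bar>x * y\<bar>, q\<^sup>2 * \<bar>x * y * z\<bar>}"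
  using assms(2)
proof (induction n rule: less_induct)
  case (less n)
  have nz: "x \<noteq> 0" "y \<noteq> 0" "z \<noteq> 0" using assms(1) by auto
  show ?case
  proof (cases "n < 16")
    case True
    have witness: ?thesis
      if "t \<in> {x * y, x * y * z}" "eds_monomial n \<in> {q\<^sup>2 * t, - (q\<^sup>2 * t)}" "q = x ^ a * y ^ b * z ^ c"
      for t q a b c
      using that nz by (intro exI[of _ q]) (auto simp: abs_mult)
    consider "n = 2" | "n = 6" | "n = 7" | "n = 9" | "n = 10" | "n = 14"
      using less.prems True by auto
    then show ?thesis
    proof cases
      case 1
      \<comment> \<open>In each case the exponents of the square root are those of the term, halved
        and rounded down; the odd ones leave \<open>x * y\<close> or
        \<open>x * y * z\<close>.\<close>
      have "eds_monomial n = - ((x ^ 1 * y ^ 0 * z ^ 0)\<^sup>2 * (x * y * z))"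
        unfolding 1 eds_monomial_base by algebra
      then show ?thesis by (intro witness[of "x * y * z" _ 1 0 0]) simp_all
    next
      case 2
      have "eds_monomial n = - ((x ^ 16 * y ^ 7 * z ^ 6)\<^sup>2 * (x * y * z))"
        unfolding 2 eds_monomial_base by algebra
      then show ?thesis by (intro witness[of "x * y * z" _ 16 7 6]) simp_all
    next
      case 3
      have "eds_monomial n = - ((x ^ 22 * y ^ 10 * z ^ 9)\<^sup>2 * (x * y))"
        unfolding 3 eds_monomial_base by algebra
      then show ?thesis by (intro witness[of "x * y" _ 22 10 9]) simp_all
    next
      case 4
      have "eds_monomial n = (x ^ 37 * y ^ 17 * z ^ 15)\<^sup>2 * (x * y)"
        unfolding 4 eds_monomial_8_to_19 by algebra
      then show ?thesis by (intro witness[of "x * y" _ 37 17 15]) simp_all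
    next
      case 5
      have "eds_monomial n = (x ^ 46 * y ^ 21 * z ^ 18)\<^sup>2 * (x * y * z)"
        unfolding 5 eds_monomial_8_to_19 by algebra
      then show ?thesis by (intro witness[of "x * y * z" _ 46 21 18]) simp_all
    next
      case 6
      have "eds_monomial n = (x ^ 91 * y ^ 42 * z ^ 36)\<^sup>2 * (x * y * z)"
        unfolding 6 eds_monomial_8_to_19 by algebra
      then show ?thesis by (intro witness[of "x * y * z" _ 91 42 36]) simp_all
    qed
  next
    case False
    define k where "k = n - 16"
    have n: "n = k + 16" using False by (simp add: k_def)
    obtain q where q: "q \<noteq> 0" "\<bar>eds_monomial k\<bar> \<in> {q\<^sup>2 * \<bar>x * y\<bar>, q\<^sup>2 * \<bar>x * y * z\<bar>}"
      using less.IH[of k] less.prems n by auto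
    \<comment> \<open>A shift by 16 multiplies the term by the square of \<open>c\<close>, so the
      class is kept and \<open>c * q\<close> replaces \<open>q\<close>.\<close>
    define c where "c = quasi_period ^ (k + 8)"
    have "c \<noteq> 0" using nz by (simp add: c_def quasi_period_def)
    moreover have "\<bar>eds_monomial n\<bar> = c\<^sup>2 * \<bar>eds_monomial k\<bar>"
      unfolding n eds_monomial_add_16 by (simp add: c_def abs_mult)
    ultimately have "c * q \<noteq> 0 \<and> \<bar>eds_monomial n\<bar> \<in> {(c * q)\<^sup>2 * \<bar>x * y\<bar>, (c * q)\<^sup>2 * \<bar>x * y * z\<bar>}"
      using q by (auto simp: power_mult_distrib mult.assoc)
    then show ?thesis by blast
  qed
qed

end

section \<open>Identification of the sequence with the monomials\<close>

lemma eds_order8_eq_monomial: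
  assumes "\<alpha> \<notin> {0, 1}" and h: "eds_order8 \<alpha> h"
  shows "h n = of_int (eds_monomial \<alpha> (\<alpha> - 1) (2 * \<alpha> - 1) n)"
proof (induction n rule: less_induct)
  case (less n)
  define W where "W = eds_monomial \<alpha> (\<alpha> - 1) (2 * \<alpha> - 1)"
  note base = eds_monomial_base[of \<alpha> "\<alpha> - 1" "2 * \<alpha> - 1", folded W_def]
  have IH: "h k = of_int (W k)" if "k < n" for k
    using less.IH that by (simp add: W_def)
  have odd: "h (2 * m + 1) = h (m + 2) * h m ^ 3 - h (m - 1) * h (m + 1) ^ 3" if "m \<ge> 2" for m
    using h that unfolding eds_order8_def by blast
  have even: "h (2 * m) = h m * (h (m + 2) * (h (m - 1))\<^sup>2 - h (m - 2) * (h (m + 1))\<^sup>2) / h 2"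
    if "m \<ge> 3" for m
    using h that unfolding eds_order8_def by blast
  have init: "h 0 = of_int (W 0)" "h 1 = of_int (W 1)" "h 2 = of_int (W 2)"
    "h 3 = of_int (W 3)" "h 4 = of_int (W 4)"
    using h by (simp_all add: eds_order8_def base)
  \<comment> \<open>An odd number is nonzero; this makes the division by \<open>h 2\<close>
    legitimate.\<close>
  have "2 * \<alpha> - 1 \<noteq> 0" by presburger
  then have "W 2 \<noteq> 0"
    using assms(1) by (simp add: base)
  \<comment> \<open>The bound \<open>j \<ge> 1\<close> gives \<open>m = j + 2 \<ge> 3\<close> and
    puts the largest index used, \<open>j + 4\<close>, below \<open>2 * j + 4\<close>.\<close>
  consider "n \<in> {0, 1, 2, 3, 4}" | j where "n = 2 * j + 5" | j where "n = 2 * j + 4" "j \<ge> 1"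
  proof -
    have "n \<in> {0, 1, 2, 3, 4} \<or> (\<exists>j. n = 2 * j + 5) \<or> (\<exists>j\<ge>1. n = 2 * j + 4)"
      by (simp; presburger)
    then show thesis using that by blast
  qed
  then have "h n = of_int (W n)"
  proof cases
    case 1
    then show ?thesis
      using init by blast
  next
    case (2 j)
    have "h n = h (j + 4) * h (j + 2) ^ 3 - h (j + 1) * h (j + 3) ^ 3"
      using odd[of "j + 2"] by (simp add: 2 eval_nat_numeral)
    also have "\<dots> = of_int (W (j + 4) * W (j + 2) ^ 3 - W (j + 1) * W (j + 3) ^ 3)"
      by (simp add: IH 2)
    also have "W (j + 4) * W (j + 2) ^ 3 - W (j + 1) * W (j + 3) ^ 3 = W n"
      unfolding W_def 2 by (rule eds_monomial_odd[symmetric]) simp_all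
    finally show ?thesis .
  next
    case (3 j)
    have "h n = h (j + 2) * (h (j + 4) * (h (j + 1))\<^sup>2 - h j * (h (j + 3))\<^sup>2) / h 2"
      using even[of "j + 2"] 3 by (simp add: eval_nat_numeral)
    also have "\<dots> = of_int (W (j + 2) * (W (j + 4) * (W (j + 1))\<^sup>2 - W j * (W (j + 3))\<^sup>2)) / of_int (W 2)"
      using 3 by (simp add: IH init)
    also have "W (j + 2) * (W (j + 4) * (W (j + 1))\<^sup>2 - W j * (W (j + 3))\<^sup>2) = W n * W 2"
      unfolding W_def 3 by (rule eds_monomial_even[symmetric]) simp_all
    also have "of_int (W n * W 2) / of_int (W 2) = (of_int (W n) :: rat)"
      using \<open>W 2 \<noteq> 0\<close> by simp
    finally show ?thesis .
  qed
  then show ?case by (simp add: W_def)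
qed

section \<open>Squares up to sign: coprime factors and pronic numbers\<close>

lemma square_factor_of_coprime_int:
  fixes a b c :: int
  assumes "coprime a b" and "\<bar>a * b\<bar> = c\<^sup>2"
  obtains d where "\<bar>a\<bar> = d\<^sup>2"
proof -
  have "nat \<bar>a\<bar> * nat \<bar>b\<bar> = nat \<bar>c\<bar> ^ 2"
    using arg_cong[OF assms(2), of nat] by (simp add: nat_abs_mult_distrib flip: nat_power_eq)
  moreover have "coprime (nat \<bar>a\<bar>) (nat \<bar>b\<bar>)"
    using assms(1) by simp
  ultimately have "is_nth_power 2 (nat \<bar>a\<bar>)"
    using is_nth_power_mult_coprime_nat_iff[of "nat \<bar>a\<bar>" "nat \<bar>b\<bar>" 2] by simp
  then obtain d where "nat \<bar>a\<bar> = d ^ 2"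
    by (auto elim: is_nth_powerE)
  then have "\<bar>a\<bar> = (int d)\<^sup>2"
    by (simp flip: of_nat_power)
  then show thesis by (rule that)
qed

lemma pronic_not_square:
  fixes \<alpha> d :: int
  assumes "\<alpha> \<notin> {0, 1}"
  shows "\<bar>\<alpha> * (\<alpha> - 1)\<bar> \<noteq> d\<^sup>2"
proof
  assume eq: "\<bar>\<alpha> * (\<alpha> - 1)\<bar> = d\<^sup>2"
  \<comment> \<open>The reflection of \<alpha> to \<open>1 - \<alpha>\<close> fixes the product, so
    it can be written as \<open>m * (m + 1)\<close> with \<open>m\<close> positive.\<close>
  define m where "m = (if \<alpha> > 0 then \<alpha> - 1 else - \<alpha>)"
  have m: "m > 0" "\<alpha> * (\<alpha> - 1) = m * (m + 1)"
    using assms by (auto simp: m_def algebra_simps)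
  then have "d\<^sup>2 = m * (m + 1)"
    using eq by simp
  then have "m\<^sup>2 < \<bar>d\<bar>\<^sup>2" "\<bar>d\<bar>\<^sup>2 < (m + 1)\<^sup>2"
    using m(1) by (auto simp: power2_eq_square algebra_simps)
  then have "m < \<bar>d\<bar>" "\<bar>d\<bar> < m + 1"
    using m(1) power2_less_imp_less[of m "\<bar>d\<bar>"] power2_less_imp_less[of "\<bar>d\<bar>" "m + 1"]
    by simp_all
  then show False by simp
qed

section \<open>Reduction of a square term to a square pronic number\<close>

theorem theorem5p12:
  fixes \<alpha> :: int and h :: "nat \<Rightarrow> rat" and n :: nat
  assumes "\<alpha> \<notin> {0, 1}"
    and "eds_order8 \<alpha> h"
    and "n mod 16 \<in> {2, 6, 7, 9, 10, 14}"
  shows "\<not> (\<exists>m. h n = of_int m \<and> signed_square m)"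
proof
  define z where "z = 2 * \<alpha> - 1"
  define W where "W = eds_monomial \<alpha> (\<alpha> - 1) z n"
  assume "\<exists>m. h n = of_int m \<and> signed_square m"
  then have "signed_square W"
    using eds_order8_eq_monomial[OF assms(1,2)] by (auto simp: W_def z_def)
  then obtain \<beta> where \<beta>: "\<bar>W\<bar> = \<beta>\<^sup>2"
    by (auto simp: signed_square_def)
  have "z \<noteq> 0" unfolding z_def by presburger
  then have "\<alpha> * (\<alpha> - 1) * z \<noteq> 0"
    using assms(1) by simp
  from eds_monomial_modulo_squares[OF this assms(3)]
  obtain q t where q: "q \<noteq> 0" and t: "t = \<alpha> * (\<alpha> - 1) \<or> t = \<alpha> * (\<alpha> - 1) * z"
    and W: "\<bar>W\<bar> = q\<^sup>2 * \<bar>t\<bar>"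
    unfolding W_def by blast
  \<comment> \<open>Divisibility of squares passes to their roots, so the square factor can be
    cancelled and \<open>t\<close> itself is a square up to sign.\<close>
  have "q\<^sup>2 dvd \<beta>\<^sup>2"
    using W \<beta> by (metis dvd_triv_left)
  then obtain c where "\<beta> = q * c"
    by (auto elim: dvdE)
  then have c: "\<bar>t\<bar> = c\<^sup>2"
    using W \<beta> q by (simp add: power_mult_distrib)
  have "coprime (\<alpha> * (\<alpha> - 1)) z"
  proof (rule coprimeI)
    fix p assume "p dvd \<alpha> * (\<alpha> - 1)" "p dvd z"
    then have "p dvd z * z - 4 * (\<alpha> * (\<alpha> - 1))"
      by (meson dvd_diff dvd_mult)
    also have "z * z - 4 * (\<alpha> * (\<alpha> - 1)) = 1"
      by (simp add: z_def algebra_simps)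
    finally show "is_unit p" .
  qed
  \<comment> \<open>If \<open>t\<close> contains the factor \<open>z\<close>, coprimality splits it
    off; otherwise \<open>d = c\<close> works.\<close>
  then obtain d where "\<bar>\<alpha> * (\<alpha> - 1)\<bar> = d\<^sup>2"
    using t c square_factor_of_coprime_int by metis
  then show False
    using pronic_not_square[OF assms(1)] by blast
qed

end
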